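(* Every pca is isomorphic to a strict pca.
   Context: A partial applicative structure on a set $A$ is a partial map $A\times A\to A$, written $(a,b)\mapsto ab$; application associates to the left. $t\downarrow$ means that $t$ is defined; $t\lesssim s$ means: if $s\downarrow$ then $t\downarrow$ and $t=s$; $t\simeq s$ means $t\lesssim s$ and $s\lesssim t$ (i.e. one side is defined iff the other is, and then they are equal). A pca (partial combinatory algebra) is a partial applicative structure $A$ for which there are $\mathsf{k},\mathsf{s}\in A$ such that for all $a,b,c\in A$: $\mathsf{s}ab\downarrow$, $\mathsf{k}ab=a$, and $\mathsf{s}abc\lesssim ac(bc)$. It is a strict pca if there are $\mathsf{k},\mathsf{s}\in A$ such that for all $a,b,c\in A$: $\mathsf{s}ab\downarrow$, $\mathsf{k}ab=a$, and $\mathsf{s}abc\simeq ac(bc)$. An applicative morphism $\gamma:A\to B$ of pcas is a total relation from $A$ to $B$ (i.e. $\gamma(a)=\{b\in B: a\,\gamma\, b\}\ne\emptyset$ for all $a\in A$) for which there is $r\in B$ such that whenever $a,a'\in A$ and $aa'\downarrow$, then for all $b\in\gamma(a)$, $b'\in\gamma(a')$ one has $rbb'\downarrow$ and $rbb'\in\gamma(aa')$. Composition is composition of relations and the identity morphism is the identity relation. Pcas and applicative morphisms form a category; "isomorphic" means isomorphic in this category. *)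

theory Defs
  imports Main
begin

text \<open>
  A partial applicative structure is a set together with a partial binary application. Values of
  \<open>app\<close> at arguments outside \<open>elts\<close> are irrelevant; all conditions are relativised to \<open>elts\<close>.
\<close>

record 'a pas =
  elts :: "'a set"
  app :: "'a \<Rightarrow> 'a \<Rightarrow> 'a option"

definition partial_applicative_structure :: "'a pas \<Rightarrow> bool" where
  "partial_applicative_structure A \<longleftrightarrow>
     (\<forall>a\<in>elts A. \<forall>b\<in>elts A. \<forall>c. app A a b = Some c \<longrightarrow> c \<in> elts A)"

text \<open>
  A closed term over \<open>A\<close> denotes a value in \<open>'a option\<close>, with \<open>None\<close> for an undefined
  term and \<open>Some a\<close> for the element \<open>a\<close>. A compound term is defined only if both of its
  subterms are.
\<close>

definition tapp :: "'a option \<Rightarrow> 'a pas \<Rightarrow> 'a option \<Rightarrow> 'a option"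
    ("(_ \<cdot>\<^bsub>_\<^esub> _)" [70, 0, 71] 70) where
  "t \<cdot>\<^bsub>A\<^esub> u = Option.bind t (\<lambda>a. Option.bind u (\<lambda>b. app A a b))"

definition defined :: "'a option \<Rightarrow> bool" ("_\<down>" [60] 60) where
  "t\<down> \<longleftrightarrow> t \<noteq> None"

text \<open>Note the orientation: the right-hand side is the one assumed to be defined.\<close>

definition lesssim :: "'a option \<Rightarrow> 'a option \<Rightarrow> bool" (infix "\<lesssim>" 50) where
  "t \<lesssim> s \<longleftrightarrow> (s\<down> \<longrightarrow> t\<down> \<and> t = s)"

definition simeq :: "'a option \<Rightarrow> 'a option \<Rightarrow> bool" (infix "\<simeq>" 50) where
  "t \<simeq> s \<longleftrightarrow> t \<lesssim> s \<and> s \<lesssim> t"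

definition pca :: "'a pas \<Rightarrow> bool" where
  "pca A \<longleftrightarrow> partial_applicative_structure A \<and>
     (\<exists>k\<in>elts A. \<exists>s\<in>elts A. \<forall>a\<in>elts A. \<forall>b\<in>elts A. \<forall>c\<in>elts A.
        (Some s \<cdot>\<^bsub>A\<^esub> Some a \<cdot>\<^bsub>A\<^esub> Some b)\<down> \<and>
        Some k \<cdot>\<^bsub>A\<^esub> Some a \<cdot>\<^bsub>A\<^esub> Some b = Some a \<and>
        Some s \<cdot>\<^bsub>A\<^esub> Some a \<cdot>\<^bsub>A\<^esub> Some b \<cdot>\<^bsub>A\<^esub> Some c
          \<lesssim> Some a \<cdot>\<^bsub>A\<^esub> Some c \<cdot>\<^bsub>A\<^esub> (Some b \<cdot>\<^bsub>A\<^esub> Some c))"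

definition strict_pca :: "'a pas \<Rightarrow> bool" where
  "strict_pca A \<longleftrightarrow> partial_applicative_structure A \<and>
     (\<exists>k\<in>elts A. \<exists>s\<in>elts A. \<forall>a\<in>elts A. \<forall>b\<in>elts A. \<forall>c\<in>elts A.
        (Some s \<cdot>\<^bsub>A\<^esub> Some a \<cdot>\<^bsub>A\<^esub> Some b)\<down> \<and>
        Some k \<cdot>\<^bsub>A\<^esub> Some a \<cdot>\<^bsub>A\<^esub> Some b = Some a \<and>
        Some s \<cdot>\<^bsub>A\<^esub> Some a \<cdot>\<^bsub>A\<^esub> Some b \<cdot>\<^bsub>A\<^esub> Some c
          \<simeq> Some a \<cdot>\<^bsub>A\<^esub> Some c \<cdot>\<^bsub>A\<^esub> (Some b \<cdot>\<^bsub>A\<^esub> Some c))"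

lemma strict_pca_imp_pca: "strict_pca A \<Longrightarrow> pca A"
  unfolding strict_pca_def pca_def simeq_def by meson

definition applicative_morphism :: "'a pas \<Rightarrow> 'b pas \<Rightarrow> ('a \<times> 'b) set \<Rightarrow> bool" where
  "applicative_morphism A B \<gamma> \<longleftrightarrow> pca A \<and> pca B \<and>
     \<gamma> \<subseteq> elts A \<times> elts B \<and> (\<forall>a\<in>elts A. \<gamma> `` {a} \<noteq> {}) \<and>
     (\<exists>r\<in>elts B. \<forall>a\<in>elts A. \<forall>a'\<in>elts A. (Some a \<cdot>\<^bsub>A\<^esub> Some a')\<down> \<longrightarrow>
        (\<forall>b\<in>\<gamma> `` {a}. \<forall>b'\<in>\<gamma> `` {a'}.
           (Some r \<cdot>\<^bsub>B\<^esub> Some b \<cdot>\<^bsub>B\<^esub> Some b')\<down> \<and>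
           the (Some r \<cdot>\<^bsub>B\<^esub> Some b \<cdot>\<^bsub>B\<^esub> Some b')
             \<in> \<gamma> `` {the (Some a \<cdot>\<^bsub>A\<^esub> Some a')}))"

text \<open>
  Isomorphism in the category of pcas, where composition is relational composition (in diagrammatic
  order) and the identity on \<open>A\<close> is the identity relation on its elements.
\<close>

definition pca_isomorphic :: "'a pas \<Rightarrow> 'b pas \<Rightarrow> bool" where
  "pca_isomorphic A B \<longleftrightarrow>
     (\<exists>\<gamma> \<delta>. applicative_morphism A B \<gamma> \<and> applicative_morphism B A \<delta> \<and>
        \<gamma> O \<delta> = Id_on (elts A) \<and> \<delta> O \<gamma> = Id_on (elts B))"

text \<open>
  An isomorphism is in particular a bijection between the underlying sets. Hence looking for a pca
  isomorphic to \<open>A\<close> among the structures on subsets of the same type is no restriction: any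
  isomorphic pca can be transported along this bijection.
\<close>

lemma pca_isomorphic_imp_bij_betw:
  assumes "pca_isomorphic A B"
  shows "\<exists>f. bij_betw f (elts A) (elts B)"
proof -
  obtain \<gamma> \<delta> where morph: "applicative_morphism A B \<gamma>" "applicative_morphism B A \<delta>"
    and comp: "\<gamma> O \<delta> = Id_on (elts A)" "\<delta> O \<gamma> = Id_on (elts B)"
    using assms unfolding pca_isomorphic_def by (elim exE conjE)
  have sub: "\<gamma> \<subseteq> elts A \<times> elts B" "\<delta> \<subseteq> elts B \<times> elts A"
    using morph unfolding applicative_morphism_def by simp_all
  have "\<forall>a\<in>elts A. \<gamma> `` {a} \<noteq> {}" "\<forall>b\<in>elts B. \<delta> `` {b} \<noteq> {}"
    using morph unfolding applicative_morphism_def by simp_all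
  then have tot: "\<forall>a\<in>elts A. \<exists>b. (a, b) \<in> \<gamma>" "\<forall>b\<in>elts B. \<exists>a. (b, a) \<in> \<delta>"
    by auto
  obtain f where f: "\<forall>a\<in>elts A. (a, f a) \<in> \<gamma>"
    using bchoice[OF tot(1)] by auto
  obtain g where g: "\<forall>b\<in>elts B. (b, g b) \<in> \<delta>"
    using bchoice[OF tot(2)] by auto
  have fg: "f a \<in> elts B" if "a \<in> elts A" for a
    using f sub that by auto
  have gf: "g b \<in> elts A" if "b \<in> elts B" for b
    using g sub that by auto
  have "g (f a) = a" if "a \<in> elts A" for a
  proof -
    have "(a, g (f a)) \<in> \<gamma> O \<delta>"
      using f g fg that by (intro relcompI) auto
    then show ?thesis by (simp add: comp Id_on_iff)
  qed
  moreover have "f (g b) = b" if "b \<in> elts B" for b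
  proof -
    have "(b, f (g b)) \<in> \<delta> O \<gamma>"
      using f g gf that by (intro relcompI) auto
    then show ?thesis by (simp add: comp Id_on_iff)
  qed
  ultimately have "bij_betw f (elts A) (elts B)"
    using fg gf by (intro bij_betw_byWitness[where f' = g]) auto
  then show ?thesis by blast
qed

end

theory Submission
  imports Defs
begin

text \<open>
  If a structure \<open>B\<close> has the same elements as \<open>A\<close>, then the identity relation is an isomorphism
  \<open>A \<rightarrow> B\<close> as soon as each of the two applications is realized inside the other structure. A
  realizer has to give the right value only where the application that it realizes is defined, so
  the application \<open>*\<close> of \<open>B\<close> can be a computation in \<open>A\<close> whose \<^emph>\<open>domain\<close> has been cut down by
  conditions that \<open>A\<close> itself cannot check. This freedom is what makes \<open>s\<close> strict.

  Write \<open>[t, g]\<close> for the pair \<open>\<lambda>z. z t g\<close>. In \<open>B\<close>, applying \<open>[t, g]\<close> to \<open>y\<close> computes \<open>g y\<close> in \<open>A\<close>;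
  the component \<open>t\<close> is a label that only governs when the result is accepted:

    \<^item> \<open>[k, g] * y\<close> is \<open>g y\<close>;
    \<^item> \<open>[[a, b], \<sigma> a b] * y\<close> is \<open>(a * y) * (b * y)\<close>, where \<open>\<sigma> a b\<close> is an element of \<open>A\<close> that
      computes this value from \<open>y\<close> whenever it exists;
    \<^item> all other \<open>x * y\<close> are undefined.

  These clauses are read as an inductive definition (\<open>strict_val\<close>). Hence
  \<open>[[a, b], \<sigma> a b] * y\<close> is undefined unless \<open>(a * y) * (b * y)\<close> is defined, even if
  \<open>\<sigma> a b y\<close> happens to have a value in \<open>A\<close>, and the element that takes \<open>a\<close> and \<open>b\<close> to
  \<open>[[a, b], \<sigma> a b]\<close> is a strict \<open>s\<close> for \<open>B\<close>. The two clauses do not interfere, because pairing is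
  injective and \<open>k\<close> is not a pair if \<open>A\<close> has at least two elements (\<open>k_not_P\<close>).

  The realizer for \<open>B \<rightarrow> A\<close> sends \<open>[t, g]\<close> and \<open>y\<close> to \<open>g y\<close> (\<open>strict_val_realized\<close>); the one for
  \<open>A \<rightarrow> B\<close> is \<open>[k, \<lambda>a. [k, a]]\<close>. A pca with only one element has a total application and is
  therefore strict already.
\<close>

section \<open>Combinatory completeness\<close>

lemma tapp_simps [simp]:
  "Some a \<cdot>\<^bsub>A\<^esub> Some b = app A a b" "None \<cdot>\<^bsub>A\<^esub> u = None" "t \<cdot>\<^bsub>A\<^esub> None = None"
  by (auto simp: tapp_def split: bind_splits)

lemma tapp_eq_Some_iff:
  "t \<cdot>\<^bsub>A\<^esub> u = Some c \<longleftrightarrow> (\<exists>a b. t = Some a \<and> u = Some b \<and> app A a b = Some c)"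
  by (auto simp: tapp_def bind_eq_Some_conv)

datatype 'a poly = Var nat | Const 'a | App "'a poly" "'a poly"

primrec eval :: "'a pas \<Rightarrow> (nat \<Rightarrow> 'a) \<Rightarrow> 'a poly \<Rightarrow> 'a option" where
  "eval A e (Var n) = Some (e n)"
| "eval A e (Const c) = Some c"
| "eval A e (App t u) = eval A e t \<cdot>\<^bsub>A\<^esub> eval A e u"

primrec abstraction :: "'a \<Rightarrow> 'a \<Rightarrow> nat \<Rightarrow> 'a poly \<Rightarrow> 'a poly" where
  "abstraction k s n (Var m) =
     (if m = n then App (App (Const s) (Const k)) (Const k) else App (Const k) (Var m))"
| "abstraction k s n (Const c) = App (Const k) (Const c)"
| "abstraction k s n (App t u) =
     App (App (Const s) (abstraction k s n t)) (abstraction k s n u)"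

lemma simeq_refl: "t \<simeq> t"
  by (simp add: simeq_def lesssim_def)

locale lax_combinators =
  fixes A :: "'a pas" and k s :: 'a
  assumes app_closed: "\<lbrakk>a \<in> elts A; b \<in> elts A; app A a b = Some c\<rbrakk> \<Longrightarrow> c \<in> elts A"
    and k_elt: "k \<in> elts A"
    and s_elt: "s \<in> elts A"
    and k_eq: "\<lbrakk>a \<in> elts A; b \<in> elts A\<rbrakk> \<Longrightarrow> Some k \<cdot>\<^bsub>A\<^esub> Some a \<cdot>\<^bsub>A\<^esub> Some b = Some a"
    and s_defined: "\<lbrakk>a \<in> elts A; b \<in> elts A\<rbrakk> \<Longrightarrow> (Some s \<cdot>\<^bsub>A\<^esub> Some a \<cdot>\<^bsub>A\<^esub> Some b)\<down>"
    and s_lax: "\<lbrakk>a \<in> elts A; b \<in> elts A; c \<in> elts A\<rbrakk> \<Longrightarrow>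
      Some s \<cdot>\<^bsub>A\<^esub> Some a \<cdot>\<^bsub>A\<^esub> Some b \<cdot>\<^bsub>A\<^esub> Some c
        \<lesssim> Some a \<cdot>\<^bsub>A\<^esub> Some c \<cdot>\<^bsub>A\<^esub> (Some b \<cdot>\<^bsub>A\<^esub> Some c)"

lemma pca_imp_lax_combinators:
  assumes "pca A"
  shows "\<exists>k s. lax_combinators A k s"
proof -
  obtain k s where "k \<in> elts A" "s \<in> elts A"
    "\<forall>a\<in>elts A. \<forall>b\<in>elts A. \<forall>c\<in>elts A.
        (Some s \<cdot>\<^bsub>A\<^esub> Some a \<cdot>\<^bsub>A\<^esub> Some b)\<down> \<and>
        Some k \<cdot>\<^bsub>A\<^esub> Some a \<cdot>\<^bsub>A\<^esub> Some b = Some a \<and>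
        Some s \<cdot>\<^bsub>A\<^esub> Some a \<cdot>\<^bsub>A\<^esub> Some b \<cdot>\<^bsub>A\<^esub> Some c
          \<lesssim> Some a \<cdot>\<^bsub>A\<^esub> Some c \<cdot>\<^bsub>A\<^esub> (Some b \<cdot>\<^bsub>A\<^esub> Some c)"
    using assms unfolding pca_def by (elim conjE bexE)
  moreover have "\<forall>a\<in>elts A. \<forall>b\<in>elts A. \<forall>c. app A a b = Some c \<longrightarrow> c \<in> elts A"
    using assms unfolding pca_def partial_applicative_structure_def by (elim conjE)
  ultimately have "lax_combinators A k s"
    by unfold_locales blast+
  then show ?thesis
    by blast
qed

context lax_combinators
begin

lemma k_app:
  assumes "a \<in> elts A"
  obtains ka where "ka \<in> elts A" "app A k a = Some ka" "\<And>b. b \<in> elts A \<Longrightarrow> app A ka b = Some a"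
proof -
  obtain ka where ka: "app A k a = Some ka"
    using k_eq[OF assms assms] by (auto simp: tapp_eq_Some_iff)
  have "app A ka b = Some a" if "b \<in> elts A" for b
    using k_eq[OF assms that] ka by simp
  then show thesis
    by (rule that[OF app_closed[OF k_elt assms ka] ka])
qed

lemma s_app:
  assumes "a \<in> elts A" "b \<in> elts A"
  obtains sab where "sab \<in> elts A" "Some s \<cdot>\<^bsub>A\<^esub> Some a \<cdot>\<^bsub>A\<^esub> Some b = Some sab"
    "\<And>c z. \<lbrakk>c \<in> elts A; app A a c \<cdot>\<^bsub>A\<^esub> app A b c = Some z\<rbrakk> \<Longrightarrow> app A sab c = Some z"
proof -
  obtain sab where sab: "Some s \<cdot>\<^bsub>A\<^esub> Some a \<cdot>\<^bsub>A\<^esub> Some b = Some sab"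
    using s_defined[OF assms] by (auto simp: defined_def)
  then obtain sa where "app A s a = Some sa" "app A sa b = Some sab"
    by (auto simp: tapp_eq_Some_iff)
  then have sab_elt: "sab \<in> elts A"
    using app_closed s_elt assms by blast
  have "app A sab c = Some z"
    if "c \<in> elts A" "app A a c \<cdot>\<^bsub>A\<^esub> app A b c = Some z" for c z
    using s_lax[OF assms that(1)] that(2) sab by (simp add: lesssim_def defined_def)
  then show thesis
    by (rule that[OF sab_elt sab])
qed

text \<open>
  Bracket abstraction survives partiality: the only applications that occur when the abstraction
  is evaluated have the forms \<open>k a\<close>, \<open>s a\<close> and \<open>s a b\<close>, so it has a value even where \<open>t\<close> is
  undefined. Since \<open>s\<close> is lax, the value may be defined at more arguments than \<open>t\<close>.
\<close>

lemma eval_abstraction: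
  assumes "set_poly t \<subseteq> elts A" "range e \<subseteq> elts A"
  shows "\<exists>f\<in>elts A. eval A e (abstraction k s n t) = Some f \<and>
    (\<forall>a\<in>elts A. \<forall>z. eval A (e(n := a)) t = Some z \<longrightarrow> app A f a = Some z)"
  using assms(1)
proof (induction t)
  case (Var m)
  show ?case
  proof (cases "m = n")
    case True
    obtain f where f: "f \<in> elts A" "Some s \<cdot>\<^bsub>A\<^esub> Some k \<cdot>\<^bsub>A\<^esub> Some k = Some f"
      "\<And>c z. \<lbrakk>c \<in> elts A; app A k c \<cdot>\<^bsub>A\<^esub> app A k c = Some z\<rbrakk> \<Longrightarrow> app A f c = Some z"
      using s_app[OF k_elt k_elt] by blast
    have "app A f a = Some a" if a: "a \<in> elts A" for a
    proof -
      obtain ka where "ka \<in> elts A" "app A k a = Some ka"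
        "\<And>b. b \<in> elts A \<Longrightarrow> app A ka b = Some a"
        using k_app[OF a] by blast
      then show ?thesis
        by (intro f(3) a) simp
    qed
    then show ?thesis
      using True f by simp
  next
    case False
    have "e m \<in> elts A"
      using assms(2) by auto
    from k_app[OF this] show ?thesis
      using False by fastforce
  qed
next
  case (Const c)
  then have "c \<in> elts A"
    by simp
  from k_app[OF this] show ?case
    by fastforce
next
  case (App t u)
  then have sub: "set_poly t \<subseteq> elts A" "set_poly u \<subseteq> elts A"
    by auto
  obtain f where f: "f \<in> elts A" "eval A e (abstraction k s n t) = Some f"
    "\<And>a z. \<lbrakk>a \<in> elts A; eval A (e(n := a)) t = Some z\<rbrakk> \<Longrightarrow> app A f a = Some z"
    using App.IH(1)[OF sub(1)] by blast
  obtain g where g: "g \<in> elts A" "eval A e (abstraction k s n u) = Some g"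
    "\<And>a z. \<lbrakk>a \<in> elts A; eval A (e(n := a)) u = Some z\<rbrakk> \<Longrightarrow> app A g a = Some z"
    using App.IH(2)[OF sub(2)] by blast
  obtain h where h: "h \<in> elts A" "Some s \<cdot>\<^bsub>A\<^esub> Some f \<cdot>\<^bsub>A\<^esub> Some g = Some h"
    "\<And>c z. \<lbrakk>c \<in> elts A; app A f c \<cdot>\<^bsub>A\<^esub> app A g c = Some z\<rbrakk> \<Longrightarrow> app A h c = Some z"
    using s_app[OF f(1) g(1)] by blast
  have "app A h a = Some z" if "a \<in> elts A" "eval A (e(n := a)) (App t u) = Some z" for a z
    using that f(3) g(3) by (intro h(3)) (auto simp: tapp_eq_Some_iff)
  then show ?case
    using h(1,2) f(2) g(2)
    by (intro bexI[of _ h]) (simp_all del: fun_upd_apply)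
qed

lemma set_abstraction: "set_poly (abstraction k s n t) \<subseteq> {k, s} \<union> set_poly t"
  by (induction t) auto

text \<open>
  Combinatory completeness for one, two and three variables. The environments send all other
  variables to \<open>k\<close>, merely to stay inside \<open>elts A\<close>. In the versions with several variables the
  partial applications are always defined, as the functions \<open>F\<close> and \<open>G\<close> record.
\<close>

lemma combinatory_complete_1:
  assumes "set_poly t \<subseteq> elts A"
  shows "\<exists>f\<in>elts A. \<forall>a\<in>elts A. \<forall>z.
    eval A ((\<lambda>_. k)(0 := a)) t = Some z \<longrightarrow> app A f a = Some z"
  using eval_abstraction[OF assms, of "\<lambda>_. k" 0] k_elt by auto

lemma combinatory_complete_2:
  assumes "set_poly t \<subseteq> elts A"
  shows "\<exists>f\<in>elts A. \<exists>F. \<forall>a\<in>elts A. F a \<in> elts A \<and> app A f a = Some (F a) \<and>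
    (\<forall>b\<in>elts A. \<forall>z. eval A ((\<lambda>_. k)(0 := a, 1 := b)) t = Some z \<longrightarrow> app A (F a) b = Some z)"
proof -
  have t': "set_poly (abstraction k s 1 t) \<subseteq> elts A"
    using set_abstraction[of 1 t] assms k_elt s_elt by auto
  obtain f where f: "f \<in> elts A"
    "\<And>a z. \<lbrakk>a \<in> elts A; eval A ((\<lambda>_. k)(0 := a)) (abstraction k s 1 t) = Some z\<rbrakk>
      \<Longrightarrow> app A f a = Some z"
    using combinatory_complete_1[OF t'] by blast
  have "\<forall>a\<in>elts A. \<exists>fa. fa \<in> elts A \<and> app A f a = Some fa \<and>
    (\<forall>b\<in>elts A. \<forall>z. eval A ((\<lambda>_. k)(0 := a, 1 := b)) t = Some z \<longrightarrow> app A fa b = Some z)"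
  proof
    fix a assume a: "a \<in> elts A"
    have "range ((\<lambda>_. k)(0 := a)) \<subseteq> elts A"
      using a k_elt by auto
    from eval_abstraction[OF assms this, of 1] f(2)[OF a]
    show "\<exists>fa. fa \<in> elts A \<and> app A f a = Some fa \<and>
      (\<forall>b\<in>elts A. \<forall>z. eval A ((\<lambda>_. k)(0 := a, 1 := b)) t = Some z \<longrightarrow> app A fa b = Some z)"
      by blast
  qed
  from bchoice[OF this] f(1) show ?thesis
    by blast
qed

lemma combinatory_complete_3:
  assumes "set_poly t \<subseteq> elts A"
  shows "\<exists>f\<in>elts A. \<exists>F G. \<forall>a\<in>elts A. F a \<in> elts A \<and> app A f a = Some (F a) \<and>
    (\<forall>b\<in>elts A. G a b \<in> elts A \<and> app A (F a) b = Some (G a b) \<and>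
      (\<forall>c\<in>elts A. \<forall>z. eval A ((\<lambda>_. k)(0 := a, 1 := b, 2 := c)) t = Some z
        \<longrightarrow> app A (G a b) c = Some z))"
proof -
  have t': "set_poly (abstraction k s 2 t) \<subseteq> elts A"
    using set_abstraction[of 2 t] assms k_elt s_elt by auto
  obtain f F where f: "f \<in> elts A"
    "\<And>a. a \<in> elts A \<Longrightarrow> F a \<in> elts A \<and> app A f a = Some (F a)"
    "\<And>a b z. \<lbrakk>a \<in> elts A; b \<in> elts A;
       eval A ((\<lambda>_. k)(0 := a, 1 := b)) (abstraction k s 2 t) = Some z\<rbrakk>
      \<Longrightarrow> app A (F a) b = Some z"
    using combinatory_complete_2[OF t'] by metis
  have "\<exists>g. g \<in> elts A \<and> app A (F a) b = Some g \<and>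
    (\<forall>c\<in>elts A. \<forall>z. eval A ((\<lambda>_. k)(0 := a, 1 := b, 2 := c)) t = Some z \<longrightarrow> app A g c = Some z)"
    if a: "a \<in> elts A" and b: "b \<in> elts A" for a b
  proof -
    have "range ((\<lambda>_. k)(0 := a, 1 := b)) \<subseteq> elts A"
      using a b k_elt by auto
    from eval_abstraction[OF assms this, of 2] f(3)[OF a b] show ?thesis
      by blast
  qed
  then have "\<forall>a\<in>elts A. \<exists>g. \<forall>b\<in>elts A. g b \<in> elts A \<and> app A (F a) b = Some (g b) \<and>
    (\<forall>c\<in>elts A. \<forall>z. eval A ((\<lambda>_. k)(0 := a, 1 := b, 2 := c)) t = Some z
      \<longrightarrow> app A (g b) c = Some z)"
    by (intro ballI bchoice)
  from bchoice[OF this] obtain G where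
    "\<forall>a\<in>elts A. \<forall>b\<in>elts A. G a b \<in> elts A \<and> app A (F a) b = Some (G a b) \<and>
      (\<forall>c\<in>elts A. \<forall>z. eval A ((\<lambda>_. k)(0 := a, 1 := b, 2 := c)) t = Some z
        \<longrightarrow> app A (G a b) c = Some z)"
    by blast
  then show ?thesis
    using f(1,2) by (intro bexI[of _ f] exI[of _ F] exI[of _ G]) blast+
qed

lemma ex_false: "\<exists>q\<in>elts A. \<forall>a\<in>elts A. \<forall>b\<in>elts A. Some q \<cdot>\<^bsub>A\<^esub> Some a \<cdot>\<^bsub>A\<^esub> Some b = Some b"
proof -
  have "\<exists>q\<in>elts A. \<exists>F. \<forall>a\<in>elts A. F a \<in> elts A \<and> app A q a = Some (F a) \<and>
    (\<forall>b\<in>elts A. app A (F a) b = Some b)"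
    using combinatory_complete_2[of "Var 1"] by simp
  then show ?thesis
    by (metis tapp_simps(1))
qed

lemma ex_pairing:
  "\<exists>p\<in>elts A. \<exists>F P. \<forall>a\<in>elts A. F a \<in> elts A \<and> app A p a = Some (F a) \<and>
    (\<forall>b\<in>elts A. P a b \<in> elts A \<and> app A (F a) b = Some (P a b) \<and>
      (\<forall>c\<in>elts A. \<forall>z. Some c \<cdot>\<^bsub>A\<^esub> Some a \<cdot>\<^bsub>A\<^esub> Some b = Some z \<longrightarrow> app A (P a b) c = Some z))"
  using combinatory_complete_3[of "App (App (Var 2) (Var 0)) (Var 1)"] by simp

text \<open>
  If \<open>q\<close> is the second boolean, then \<open>a q y\<close> applies the second component of the pair \<open>a\<close> to \<open>y\<close>,
  which is how \<open>a * y\<close> will be computed. So \<open>G a b y\<close> computes \<open>(a * y) * (b * y)\<close>.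
\<close>

lemma ex_sigma:
  assumes "q \<in> elts A"
  shows "\<exists>p\<in>elts A. \<exists>F G. \<forall>a\<in>elts A. F a \<in> elts A \<and> app A p a = Some (F a) \<and>
    (\<forall>b\<in>elts A. G a b \<in> elts A \<and> app A (F a) b = Some (G a b) \<and>
      (\<forall>y\<in>elts A. \<forall>z.
        Some a \<cdot>\<^bsub>A\<^esub> Some q \<cdot>\<^bsub>A\<^esub> Some y \<cdot>\<^bsub>A\<^esub> Some q \<cdot>\<^bsub>A\<^esub> (Some b \<cdot>\<^bsub>A\<^esub> Some q \<cdot>\<^bsub>A\<^esub> Some y) = Some z
        \<longrightarrow> app A (G a b) y = Some z))"
  using combinatory_complete_3[of "App (App (App (App (Var 0) (Const q)) (Var 2)) (Const q))
    (App (App (Var 1) (Const q)) (Var 2))"] assms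
  by simp

end

section \<open>The strict application\<close>

text \<open>
  Here \<open>q\<close> is the second boolean, \<open>P a b\<close> is the pair \<open>[a, b]\<close> and \<open>G a b\<close> is \<open>\<sigma> a b\<close>; the elements
  \<open>PF a\<close> and \<open>SF a\<close> are the values of the combinators \<open>pairing\<close> and \<open>sigma\<close> at their first argument.
\<close>

locale strictification = lax_combinators +
  fixes q :: 'a and pairing sigma :: 'a and PF SF :: "'a \<Rightarrow> 'a" and P G :: "'a \<Rightarrow> 'a \<Rightarrow> 'a"
  assumes nontrivial: "\<exists>a\<in>elts A. \<exists>b\<in>elts A. a \<noteq> b"
    and q_elt: "q \<in> elts A"
    and q_eq: "\<lbrakk>a \<in> elts A; b \<in> elts A\<rbrakk> \<Longrightarrow> Some q \<cdot>\<^bsub>A\<^esub> Some a \<cdot>\<^bsub>A\<^esub> Some b = Some b"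
    and pairing_elt: "pairing \<in> elts A"
    and pairing: "a \<in> elts A \<Longrightarrow> PF a \<in> elts A \<and> app A pairing a = Some (PF a)"
      "\<lbrakk>a \<in> elts A; b \<in> elts A\<rbrakk> \<Longrightarrow> P a b \<in> elts A \<and> app A (PF a) b = Some (P a b)"
    and P_eq: "\<lbrakk>a \<in> elts A; b \<in> elts A; c \<in> elts A; Some c \<cdot>\<^bsub>A\<^esub> Some a \<cdot>\<^bsub>A\<^esub> Some b = Some z\<rbrakk>
      \<Longrightarrow> app A (P a b) c = Some z"
    and sigma_elt: "sigma \<in> elts A"
    and sigma: "a \<in> elts A \<Longrightarrow> SF a \<in> elts A \<and> app A sigma a = Some (SF a)"
      "\<lbrakk>a \<in> elts A; b \<in> elts A\<rbrakk> \<Longrightarrow> G a b \<in> elts A \<and> app A (SF a) b = Some (G a b)"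
    and G_eq: "\<lbrakk>a \<in> elts A; b \<in> elts A; y \<in> elts A;
      Some a \<cdot>\<^bsub>A\<^esub> Some q \<cdot>\<^bsub>A\<^esub> Some y \<cdot>\<^bsub>A\<^esub> Some q \<cdot>\<^bsub>A\<^esub> (Some b \<cdot>\<^bsub>A\<^esub> Some q \<cdot>\<^bsub>A\<^esub> Some y) = Some z\<rbrakk>
      \<Longrightarrow> app A (G a b) y = Some z"

lemma (in lax_combinators) ex_strictification:
  assumes "a \<in> elts A" "b \<in> elts A" "a \<noteq> b"
  shows "\<exists>q pairing sigma PF SF P G. strictification A k s q pairing sigma PF SF P G"
proof -
  obtain q where q: "q \<in> elts A"
    "\<forall>a\<in>elts A. \<forall>b\<in>elts A. Some q \<cdot>\<^bsub>A\<^esub> Some a \<cdot>\<^bsub>A\<^esub> Some b = Some b"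
    using ex_false by blast
  obtain p PF P where p: "p \<in> elts A"
    "\<forall>a\<in>elts A. PF a \<in> elts A \<and> app A p a = Some (PF a) \<and>
    (\<forall>b\<in>elts A. P a b \<in> elts A \<and> app A (PF a) b = Some (P a b) \<and>
      (\<forall>c\<in>elts A. \<forall>z. Some c \<cdot>\<^bsub>A\<^esub> Some a \<cdot>\<^bsub>A\<^esub> Some b = Some z \<longrightarrow> app A (P a b) c = Some z))"
    using ex_pairing by blast
  obtain f SF G where f: "f \<in> elts A"
    "\<forall>a\<in>elts A. SF a \<in> elts A \<and> app A f a = Some (SF a) \<and>
    (\<forall>b\<in>elts A. G a b \<in> elts A \<and> app A (SF a) b = Some (G a b) \<and>
      (\<forall>y\<in>elts A. \<forall>z.
        Some a \<cdot>\<^bsub>A\<^esub> Some q \<cdot>\<^bsub>A\<^esub> Some y \<cdot>\<^bsub>A\<^esub> Some q \<cdot>\<^bsub>A\<^esub> (Some b \<cdot>\<^bsub>A\<^esub> Some q \<cdot>\<^bsub>A\<^esub> Some y) = Some z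
        \<longrightarrow> app A (G a b) y = Some z))"
    using ex_sigma[OF q(1)] by blast
  have "strictification A k s q p f PF SF P G"
    by unfold_locales (use assms q p f in blast)+
  then show ?thesis
    by blast
qed

context strictification
begin

lemma snd_P: "\<lbrakk>a \<in> elts A; b \<in> elts A\<rbrakk> \<Longrightarrow> app A (P a b) q = Some b"
  using P_eq q_elt q_eq by blast

lemma P_inject:
  assumes "a \<in> elts A" "b \<in> elts A" "a' \<in> elts A" "b' \<in> elts A" "P a b = P a' b'"
  shows "a = a' \<and> b = b'"
proof -
  have "app A (P a b) k = Some a" "app A (P a' b') k = Some a'"
    using P_eq k_elt k_eq assms by blast+
  moreover have "app A (P a b) q = Some b" "app A (P a' b') q = Some b'"
    using snd_P assms by blast+
  ultimately show ?thesis
    using assms(5) by simp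
qed

text \<open>
  A pair sends \<open>k (k c)\<close> to \<open>c\<close>. If \<open>k\<close> did so, then \<open>c n = k (k (k c)) n = k (k c)\<close> would not
  depend on \<open>n\<close>, which is absurd when \<open>c\<close> is the identity.
\<close>

lemma k_not_P:
  assumes ab: "a \<in> elts A" "b \<in> elts A"
  shows "k \<noteq> P a b"
proof
  assume eq: "k = P a b"
  \<comment> \<open>The element \<open>c = q k\<close> is an identity, since \<open>q\<close> is the second boolean.\<close>
  obtain c where c: "app A q k = Some c" "c \<in> elts A"
    using q_eq[OF k_elt k_elt] app_closed[OF q_elt k_elt] by (auto simp: tapp_eq_Some_iff)
  have c_id: "app A c n = Some n" if "n \<in> elts A" for n
    using q_eq[OF k_elt that] c by simp
  obtain kc where kc: "kc \<in> elts A" "app A k c = Some kc"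
    "\<And>n. n \<in> elts A \<Longrightarrow> app A kc n = Some c"
    using k_app[OF c(2)] by blast
  obtain kkc where kkc: "kkc \<in> elts A" "app A k kc = Some kkc"
    "\<And>n. n \<in> elts A \<Longrightarrow> app A kkc n = Some kc"
    using k_app[OF kc(1)] by blast
  have "app A (P a b) kkc = Some c"
    by (rule P_eq) (use ab kkc kc in auto)
  then have "app A k kkc = Some c"
    using eq by simp
  moreover have "Some k \<cdot>\<^bsub>A\<^esub> Some kkc \<cdot>\<^bsub>A\<^esub> Some n = Some kkc" if "n \<in> elts A" for n
    using k_eq kkc(1) that by blast
  ultimately have "n = kkc" if "n \<in> elts A" for n
    using c_id[OF that] that by fastforce
  then show False
    using nontrivial by metis
qed

inductive strict_val :: "'a \<Rightarrow> 'a \<Rightarrow> 'a \<Rightarrow> bool" where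
  basic: "\<lbrakk>g \<in> elts A; y \<in> elts A; app A g y = Some z\<rbrakk> \<Longrightarrow> strict_val (P k g) y z"
| composite: "\<lbrakk>a \<in> elts A; b \<in> elts A; y \<in> elts A;
    strict_val a y u; strict_val b y v; strict_val u v z\<rbrakk>
    \<Longrightarrow> strict_val (P (P a b) (G a b)) y z"

text \<open>
  One and the same computation in \<open>A\<close> yields all values, which gives both their uniqueness and a
  realizer. No fixed point combinator is needed for the composite case: the induction hypotheses
  say that the three smaller evaluations are values of the same computation, and \<open>G a b\<close> performs
  exactly these three.
\<close>

lemma strict_val_realized: "strict_val x y z \<Longrightarrow> Some x \<cdot>\<^bsub>A\<^esub> Some q \<cdot>\<^bsub>A\<^esub> Some y = Some z"
proof (induction rule: strict_val.induct)
  case (basic g y z)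
  then show ?case
    using snd_P[OF k_elt] by simp
next
  case (composite a b y u v z)
  have "app A (P (P a b) (G a b)) q = Some (G a b)"
    using composite.hyps(1,2) by (simp add: snd_P pairing(2) sigma(2))
  moreover have "app A (G a b) y = Some z"
    by (rule G_eq) (use composite.hyps(1-3) composite.IH in simp_all)
  ultimately show ?case
    by simp
qed

lemma strict_val_unique: "\<lbrakk>strict_val x y z; strict_val x y z'\<rbrakk> \<Longrightarrow> z = z'"
  using strict_val_realized[of x y z] strict_val_realized[of x y z'] by simp

lemma strict_val_elts: "strict_val x y z \<Longrightarrow> z \<in> elts A"
  by (induction rule: strict_val.induct) (auto intro: app_closed)

text \<open>
  The strictness of \<open>B\<close>: no other clause can have produced the value, as the label \<open>P a b\<close> is not
  \<open>k\<close> and determines \<open>a\<close> and \<open>b\<close>.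
\<close>

lemma strict_val_compositeD:
  assumes "strict_val (P (P a b) (G a b)) y z" "a \<in> elts A" "b \<in> elts A"
  shows "\<exists>u v. strict_val a y u \<and> strict_val b y v \<and> strict_val u v z"
  using assms(1)
proof cases
  case (basic g)
  then show ?thesis
    using P_inject[of "P a b" "G a b" k g] k_not_P[of a b] assms k_elt
    by (simp add: pairing(2) sigma(2))
next
  case (composite a' b' u v)
  then have "P a b = P a' b'"
    using P_inject[of "P a b" "G a b" "P a' b'" "G a' b'"] assms
    by (simp add: pairing(2) sigma(2))
  then have "a = a' \<and> b = b'"
    using P_inject composite assms by blast
  then show ?thesis
    using composite by blast
qed

definition strictified :: "'a pas" where
  "strictified = \<lparr>elts = elts A,
     app = \<lambda>x y. if \<exists>z. strict_val x y z then Some (THE z. strict_val x y z) else None\<rparr>"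

lemma elts_strictified [simp]: "elts strictified = elts A"
  by (simp add: strictified_def)

lemma app_strictified_iff: "app strictified x y = Some z \<longleftrightarrow> strict_val x y z"
proof -
  have "(THE z. strict_val x y z) = z" if "strict_val x y z" for z
    using that strict_val_unique by blast
  then show ?thesis
    by (auto simp: strictified_def)
qed

lemma app_P_k:
  "\<lbrakk>g \<in> elts A; y \<in> elts A; app A g y = Some z\<rbrakk> \<Longrightarrow> app strictified (P k g) y = Some z"
  by (simp add: app_strictified_iff basic)

lemma app_composite:
  assumes "a \<in> elts A" "b \<in> elts A" "y \<in> elts A"
  shows "Some (P (P a b) (G a b)) \<cdot>\<^bsub>strictified\<^esub> Some y
    = Some a \<cdot>\<^bsub>strictified\<^esub> Some y \<cdot>\<^bsub>strictified\<^esub> (Some b \<cdot>\<^bsub>strictified\<^esub> Some y)"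
  (is "?l = ?r")
proof -
  have "?l = Some z \<longleftrightarrow> ?r = Some z" for z
    using assms strict_val_compositeD composite
    by (auto simp: app_strictified_iff tapp_eq_Some_iff)
  then show ?thesis
    by (metis option.exhaust)
qed

lemma strict_pca_strictified: "strict_pca strictified"
proof -
  \<comment> \<open>The combinators of \<open>B\<close> are \<open>[k, g1]\<close> with \<open>g1 a = [k, k a]\<close>, and \<open>[k, g2]\<close> with
    \<open>g2 a = [k, g3 a]\<close> and \<open>g3 a b = [[a, b], \<sigma> a b]\<close>.\<close>
  have "set_poly (App (App (Const pairing) (Const k)) (App (Const k) (Var 0))) \<subseteq> elts A"
    using pairing_elt k_elt by simp
  from combinatory_complete_1[OF this] obtain g1 where g1_elt: "g1 \<in> elts A" and
    g1': "\<And>a z. \<lbrakk>a \<in> elts A;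
      eval A ((\<lambda>_. k)(0 := a)) (App (App (Const pairing) (Const k)) (App (Const k) (Var 0))) = Some z\<rbrakk>
      \<Longrightarrow> app A g1 a = Some z"
    by blast
  have g1: "app A g1 a = Some (P k ka)" if "a \<in> elts A" "ka \<in> elts A" "app A k a = Some ka" for a ka
    by (rule g1') (use that pairing k_elt in simp_all)
  let ?t3 = "App (App (Const pairing) (App (App (Const pairing) (Var 0)) (Var 1)))
    (App (App (Const sigma) (Var 0)) (Var 1))"
  have "set_poly ?t3 \<subseteq> elts A"
    using pairing_elt sigma_elt by simp
  from combinatory_complete_2[OF this] obtain f g3 where f: "f \<in> elts A"
    "\<And>a. a \<in> elts A \<Longrightarrow> g3 a \<in> elts A" "\<And>a. a \<in> elts A \<Longrightarrow> app A f a = Some (g3 a)" and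
    g3': "\<And>a b z. \<lbrakk>a \<in> elts A; b \<in> elts A; eval A ((\<lambda>_. k)(0 := a, 1 := b)) ?t3 = Some z\<rbrakk>
      \<Longrightarrow> app A (g3 a) b = Some z"
    by blast
  have g3: "app A (g3 a) b = Some (P (P a b) (G a b))" if "a \<in> elts A" "b \<in> elts A" for a b
    by (rule g3') (use that pairing sigma in simp_all)
  have "set_poly (App (App (Const pairing) (Const k)) (App (Const f) (Var 0))) \<subseteq> elts A"
    using pairing_elt k_elt f(1) by simp
  from combinatory_complete_1[OF this] obtain g2 where g2_elt: "g2 \<in> elts A" and
    g2': "\<And>a z. \<lbrakk>a \<in> elts A;
      eval A ((\<lambda>_. k)(0 := a)) (App (App (Const pairing) (Const k)) (App (Const f) (Var 0))) = Some z\<rbrakk>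
      \<Longrightarrow> app A g2 a = Some z"
    by blast
  have g2: "app A g2 a = Some (P k (g3 a))" if "a \<in> elts A" for a
    by (rule g2') (use that pairing f k_elt in simp_all)
  have K: "Some (P k g1) \<cdot>\<^bsub>strictified\<^esub> Some a \<cdot>\<^bsub>strictified\<^esub> Some b = Some a"
    if ab: "a \<in> elts A" "b \<in> elts A" for a b
  proof -
    obtain ka where ka: "ka \<in> elts A" "app A k a = Some ka"
      "\<And>b. b \<in> elts A \<Longrightarrow> app A ka b = Some a"
      using k_app[OF ab(1)] by blast
    have "app strictified (P k g1) a = Some (P k ka)"
      using app_P_k[OF g1_elt ab(1) g1[OF ab(1) ka(1,2)]] .
    moreover have "app strictified (P k ka) b = Some a"
      using app_P_k[OF ka(1) ab(2) ka(3)[OF ab(2)]] .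
    ultimately show ?thesis
      by simp
  qed
  have S: "Some (P k g2) \<cdot>\<^bsub>strictified\<^esub> Some a \<cdot>\<^bsub>strictified\<^esub> Some b = Some (P (P a b) (G a b))"
    if ab: "a \<in> elts A" "b \<in> elts A" for a b
  proof -
    have "app strictified (P k g2) a = Some (P k (g3 a))"
      using app_P_k[OF g2_elt ab(1) g2[OF ab(1)]] .
    moreover have "app strictified (P k (g3 a)) b = Some (P (P a b) (G a b))"
      using app_P_k[OF f(2)[OF ab(1)] ab(2) g3[OF ab]] .
    ultimately show ?thesis
      by simp
  qed
  have "partial_applicative_structure strictified"
    unfolding partial_applicative_structure_def app_strictified_iff elts_strictified
    using strict_val_elts by blast
  moreover have "P k g1 \<in> elts A" "P k g2 \<in> elts A"
    using g1_elt g2_elt k_elt pairing(2) by simp_all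
  ultimately show ?thesis
    unfolding strict_pca_def elts_strictified
    by (intro conjI bexI[of _ "P k g1"] bexI[of _ "P k g2"] ballI)
      (simp_all only: K S defined_def app_composite simeq_refl option.distinct not_False_eq_True)
qed

end

section \<open>Isomorphism by the identity relation\<close>

lemma applicative_morphism_Id:
  assumes "pca A" "pca B" "elts A = elts B" "r \<in> elts B"
    and "\<And>a b c. \<lbrakk>a \<in> elts A; b \<in> elts A; app A a b = Some c\<rbrakk>
      \<Longrightarrow> Some r \<cdot>\<^bsub>B\<^esub> Some a \<cdot>\<^bsub>B\<^esub> Some b = Some c"
  shows "applicative_morphism A B (Id_on (elts A))"
proof -
  have realized: "(Some r \<cdot>\<^bsub>B\<^esub> Some b \<cdot>\<^bsub>B\<^esub> Some b')\<down> \<and>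
      the (Some r \<cdot>\<^bsub>B\<^esub> Some b \<cdot>\<^bsub>B\<^esub> Some b') \<in> Id_on (elts A) `` {the (Some a \<cdot>\<^bsub>A\<^esub> Some a')}"
    if a: "a \<in> elts A" "a' \<in> elts A" "(Some a \<cdot>\<^bsub>A\<^esub> Some a')\<down>"
      and b: "b \<in> Id_on (elts A) `` {a}" "b' \<in> Id_on (elts A) `` {a'}" for a a' b b'
  proof -
    obtain c where c: "app A a a' = Some c"
      using a(3) by (auto simp: defined_def)
    then have "c \<in> elts A"
      using assms(1) a(1,2) unfolding pca_def partial_applicative_structure_def by blast
    moreover have "b = a" "b' = a'"
      using b by auto
    ultimately show ?thesis
      using assms(5)[OF a(1,2) c] c by (simp add: defined_def Id_on_iff Image_singleton_iff)
  qed
  have sub: "Id_on (elts A) \<subseteq> elts A \<times> elts B"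
    using assms(3) by auto
  have total: "Id_on (elts A) `` {a} \<noteq> {}" if "a \<in> elts A" for a
    using that by auto
  show ?thesis
    unfolding applicative_morphism_def
    by (intro conjI bexI[of _ r] ballI impI;
        rule assms(1) assms(2) assms(4) sub total realized[THEN conjunct1] realized[THEN conjunct2];
        assumption)
qed

lemma pca_isomorphic_Id:
  assumes "applicative_morphism A B (Id_on (elts A))" "applicative_morphism B A (Id_on (elts A))"
    and "elts A = elts B"
  shows "pca_isomorphic A B"
  unfolding pca_isomorphic_def
  using assms by (intro exI[of _ "Id_on (elts A)"]) auto

lemma (in lax_combinators) ex_app_realizer:
  "\<exists>r\<in>elts A. \<forall>a\<in>elts A. \<forall>b\<in>elts A. \<forall>c.
    app A a b = Some c \<longrightarrow> Some r \<cdot>\<^bsub>A\<^esub> Some a \<cdot>\<^bsub>A\<^esub> Some b = Some c"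
proof -
  have "\<exists>r\<in>elts A. \<exists>F. \<forall>a\<in>elts A. F a \<in> elts A \<and> app A r a = Some (F a) \<and>
    (\<forall>b\<in>elts A. \<forall>c. app A a b = Some c \<longrightarrow> app A (F a) b = Some c)"
    using combinatory_complete_2[of "App (Var 0) (Var 1)"] by simp
  then show ?thesis
    by (metis tapp_simps(1))
qed

lemma pca_isomorphic_refl:
  assumes "pca A"
  shows "pca_isomorphic A A"
proof -
  obtain k s where "lax_combinators A k s"
    using pca_imp_lax_combinators[OF assms] by blast
  from lax_combinators.ex_app_realizer[OF this] show ?thesis
    using applicative_morphism_Id[OF assms assms] pca_isomorphic_Id by blast
qed

lemma (in strictification) ex_realizer:
  "\<exists>r\<in>elts A. \<forall>a\<in>elts A. \<forall>b\<in>elts A. \<forall>c.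
    Some a \<cdot>\<^bsub>A\<^esub> Some q \<cdot>\<^bsub>A\<^esub> Some b = Some c \<longrightarrow> Some r \<cdot>\<^bsub>A\<^esub> Some a \<cdot>\<^bsub>A\<^esub> Some b = Some c"
proof -
  have "\<exists>r\<in>elts A. \<exists>F. \<forall>a\<in>elts A. F a \<in> elts A \<and> app A r a = Some (F a) \<and>
    (\<forall>b\<in>elts A. \<forall>c. app A a q \<cdot>\<^bsub>A\<^esub> Some b = Some c \<longrightarrow> app A (F a) b = Some c)"
    using combinatory_complete_2[of "App (App (Var 0) (Const q)) (Var 1)"] q_elt by simp
  then show ?thesis
    by (metis tapp_simps(1))
qed

lemma (in strictification) pca_isomorphic_strictified:
  assumes "pca A"
  shows "pca_isomorphic A strictified"
proof -
  have B: "pca strictified"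
    by (intro strict_pca_imp_pca strict_pca_strictified)
  \<comment> \<open>\<open>PF k\<close> is \<open>\<lambda>a. [k, a]\<close>.\<close>
  have PFk: "PF k \<in> elts A" "\<And>a. a \<in> elts A \<Longrightarrow> app A (PF k) a = Some (P k a)"
    using pairing k_elt by auto
  have "applicative_morphism A strictified (Id_on (elts A))"
  proof (rule applicative_morphism_Id[OF assms B])
    show "P k (PF k) \<in> elts strictified"
      using PFk k_elt pairing(2) by simp
    show "Some (P k (PF k)) \<cdot>\<^bsub>strictified\<^esub> Some a \<cdot>\<^bsub>strictified\<^esub> Some b = Some c"
      if "a \<in> elts A" "b \<in> elts A" "app A a b = Some c" for a b c
      using that PFk app_P_k by simp
  qed simp
  moreover obtain r where "r \<in> elts A"
    "\<And>a b c. \<lbrakk>a \<in> elts A; b \<in> elts A; Some a \<cdot>\<^bsub>A\<^esub> Some q \<cdot>\<^bsub>A\<^esub> Some b = Some c\<rbrakk>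
      \<Longrightarrow> Some r \<cdot>\<^bsub>A\<^esub> Some a \<cdot>\<^bsub>A\<^esub> Some b = Some c"
    using ex_realizer by blast
  then have "applicative_morphism strictified A (Id_on (elts strictified))"
    by (intro applicative_morphism_Id[OF B assms])
      (auto simp: app_strictified_iff dest: strict_val_realized)
  ultimately show ?thesis
    by (intro pca_isomorphic_Id) simp_all
qed

lemma strict_pca_if_trivial:
  assumes "pca A" "\<And>a b. \<lbrakk>a \<in> elts A; b \<in> elts A\<rbrakk> \<Longrightarrow> a = b"
  shows "strict_pca A"
proof -
  obtain k s where "lax_combinators A k s"
    using pca_imp_lax_combinators[OF assms(1)] by blast
  then interpret lax_combinators A k s .
  have elts: "a = k" if "a \<in> elts A" for a
    using assms(2) that k_elt by blast
  have app_kk: "app A k k = Some k"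
    using k_app[OF k_elt] elts by metis
  have "(Some k \<cdot>\<^bsub>A\<^esub> Some a \<cdot>\<^bsub>A\<^esub> Some b)\<down> \<and>
      Some k \<cdot>\<^bsub>A\<^esub> Some a \<cdot>\<^bsub>A\<^esub> Some b = Some a \<and>
      Some k \<cdot>\<^bsub>A\<^esub> Some a \<cdot>\<^bsub>A\<^esub> Some b \<cdot>\<^bsub>A\<^esub> Some c
        \<simeq> Some a \<cdot>\<^bsub>A\<^esub> Some c \<cdot>\<^bsub>A\<^esub> (Some b \<cdot>\<^bsub>A\<^esub> Some c)"
    if "a \<in> elts A" "b \<in> elts A" "c \<in> elts A" for a b c
    using that[THEN elts] app_kk by (simp add: defined_def simeq_def lesssim_def)
  moreover have "partial_applicative_structure A"
    using assms(1) by (simp only: pca_def)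
  ultimately show ?thesis
    using k_elt unfolding strict_pca_def by blast
qed

theorem theorem5p8:
  fixes A :: "'a pas"
  assumes "pca A"
  shows "\<exists>B :: 'a pas. strict_pca B \<and> pca_isomorphic A B"
proof (cases "\<exists>a\<in>elts A. \<exists>b\<in>elts A. a \<noteq> b")
  case True
  obtain k s where "lax_combinators A k s"
    using pca_imp_lax_combinators[OF assms] by blast
  moreover obtain a b where "a \<in> elts A" "b \<in> elts A" "a \<noteq> b"
    using True by blast
  ultimately obtain q pairing sigma PF SF P G
    where "strictification A k s q pairing sigma PF SF P G"
    using lax_combinators.ex_strictification[of A k s a b] by metis
  then interpret strictification A k s q pairing sigma PF SF P G .
  show ?thesis
    using strict_pca_strictified pca_isomorphic_strictified[OF assms] by blast
next
  case False
  then show ?thesis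
    using strict_pca_if_trivial[OF assms] pca_isomorphic_refl[OF assms] by blast
qed

end
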